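(* Let $\mathbb{M}$ be a monster model of a complete $C$-minimal expansion of ACVF whose language contains a constant symbol $t$ with $v(t)>0$. Let $D\subseteq\mathrm{RV}$ be definable. Then there is a definable set $\tilde D\subseteq\Gamma$ such that the symmetric difference of $D$ and $\mathrm{RV}_{\tilde D}$ is finite.
   Context: ACVF is the theory of algebraically closed non-trivially valued fields; $C$-minimal means every definable subset of the home sort is a finite boolean combination of balls and points. "Definable" means with parameters. $\Gamma$ is the value group, $\mathfrak m$ the maximal ideal, $k$ the residue field. $\mathrm{RV}=\mathbb{M}^\times/(1+\mathfrak m)$; $v$ induces a surjection $\mathrm{RV}\to\Gamma$, and for $X\subseteq\Gamma$, $\mathrm{RV}_X$ is the preimage of $X$ under this map. *)

theory Defs
  imports
    Complex_Main
    "HOL-Library.Extended"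
    "HOL-Computational_Algebra.Computational_Algebra"
begin

section \<open>First-order logic\<close>

record ('f, 'r) lang =
  fun_syms :: "'f set"
  fun_arity :: "'f \<Rightarrow> nat"
  rel_syms :: "'r set"
  rel_arity :: "'r \<Rightarrow> nat"

text \<open>
  Formulas may contain parameters: \<open>Par a\<close> is the constant symbol naming the element \<open>a\<close> of
  the universe, so that a formula with parameters in \<open>A\<close> is an \<open>L(A)\<close>-formula.
\<close>

datatype (dead 'f, pars_trm: 'a) trm =
    Var nat
  | Par 'a
  | App 'f "('f, 'a) trm list"
  for map: map_pars_trm

datatype (dead 'f, dead 'r, pars: 'a) fm =
    Eq "('f, 'a) trm" "('f, 'a) trm"
  | Rel 'r "('f, 'a) trm list"
  | Neg "('f, 'r, 'a) fm"
  | Conj "('f, 'r, 'a) fm" "('f, 'r, 'a) fm"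
  | Ex nat "('f, 'r, 'a) fm"
  for map: map_pars

fun wf_trm :: "('f, 'r) lang \<Rightarrow> ('f, 'a) trm \<Rightarrow> bool" where
  "wf_trm L (Var i) = True"
| "wf_trm L (Par a) = True"
| "wf_trm L (App f ts) =
    (f \<in> fun_syms L \<and> length ts = fun_arity L f \<and> (\<forall>u\<in>set ts. wf_trm L u))"

fun wf_fm :: "('f, 'r) lang \<Rightarrow> ('f, 'r, 'a) fm \<Rightarrow> bool" where
  "wf_fm L (Eq t u) = (wf_trm L t \<and> wf_trm L u)"
| "wf_fm L (Rel R ts) =
    (R \<in> rel_syms L \<and> length ts = rel_arity L R \<and> (\<forall>u\<in>set ts. wf_trm L u))"
| "wf_fm L (Neg \<phi>) = wf_fm L \<phi>"
| "wf_fm L (Conj \<phi> \<psi>) = (wf_fm L \<phi> \<and> wf_fm L \<psi>)"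
| "wf_fm L (Ex i \<phi>) = wf_fm L \<phi>"

fun fv_trm :: "('f, 'a) trm \<Rightarrow> nat set" where
  "fv_trm (Var i) = {i}"
| "fv_trm (Par a) = {}"
| "fv_trm (App f ts) = (\<Union>u\<in>set ts. fv_trm u)"

fun fv :: "('f, 'r, 'a) fm \<Rightarrow> nat set" where
  "fv (Eq t u) = fv_trm t \<union> fv_trm u"
| "fv (Rel R ts) = (\<Union>u\<in>set ts. fv_trm u)"
| "fv (Neg \<phi>) = fv \<phi>"
| "fv (Conj \<phi> \<psi>) = fv \<phi> \<union> fv \<psi>"
| "fv (Ex i \<phi>) = fv \<phi> - {i}"

text \<open>
  The universe of a structure is the whole type \<open>'a\<close>. Values of \<open>fun_int\<close> and \<open>rel_int\<close> outside
  the symbols of the language, or on lists of the wrong length, are irrelevant.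
\<close>

record ('f, 'r, 'a) struct =
  fun_int :: "'f \<Rightarrow> 'a list \<Rightarrow> 'a"
  rel_int :: "'r \<Rightarrow> 'a list \<Rightarrow> bool"

fun eval_trm :: "('f, 'r, 'a) struct \<Rightarrow> (nat \<Rightarrow> 'a) \<Rightarrow> ('f, 'a) trm \<Rightarrow> 'a" where
  "eval_trm M e (Var i) = e i"
| "eval_trm M e (Par a) = a"
| "eval_trm M e (App f ts) = fun_int M f (map (eval_trm M e) ts)"

fun sat :: "('f, 'r, 'a) struct \<Rightarrow> (nat \<Rightarrow> 'a) \<Rightarrow> ('f, 'r, 'a) fm \<Rightarrow> bool" where
  "sat M e (Eq t u) = (eval_trm M e t = eval_trm M e u)"
| "sat M e (Rel R ts) = rel_int M R (map (eval_trm M e) ts)"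
| "sat M e (Neg \<phi>) = (\<not> sat M e \<phi>)"
| "sat M e (Conj \<phi> \<psi>) = (sat M e \<phi> \<and> sat M e \<psi>)"
| "sat M e (Ex i \<phi>) = (\<exists>a. sat M (e(i := a)) \<phi>)"

definition formulas_over :: "('f, 'r) lang \<Rightarrow> 'a set \<Rightarrow> ('f, 'r, 'a) fm set" where
  "formulas_over L A = {\<phi>. wf_fm L \<phi> \<and> pars \<phi> \<subseteq> A}"

definition sentences_over :: "('f, 'r) lang \<Rightarrow> 'a set \<Rightarrow> ('f, 'r, 'a) fm set" where
  "sentences_over L A = {\<phi> \<in> formulas_over L A. fv \<phi> = {}}"

definition formulas1_over :: "('f, 'r) lang \<Rightarrow> 'a set \<Rightarrow> ('f, 'r, 'a) fm set" where
  "formulas1_over L A = {\<phi> \<in> formulas_over L A. fv \<phi> \<subseteq> {0}}"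

definition holds :: "('f, 'r, 'a) struct \<Rightarrow> ('f, 'r, 'a) fm \<Rightarrow> bool" where
  "holds M \<phi> \<longleftrightarrow> (\<forall>e. sat M e \<phi>)"

text \<open>For a formula in the single free variable \<open>0\<close>, so the other values are irrelevant.\<close>

definition holds_at :: "('f, 'r, 'a) struct \<Rightarrow> 'a \<Rightarrow> ('f, 'r, 'a) fm \<Rightarrow> bool" where
  "holds_at M a \<phi> \<longleftrightarrow> sat M (\<lambda>_. a) \<phi>"

definition definable :: "('f, 'r) lang \<Rightarrow> ('f, 'r, 'a) struct \<Rightarrow> 'a set \<Rightarrow> bool" where
  "definable L M X \<longleftrightarrow> (\<exists>\<phi> \<in> formulas1_over L UNIV. X = {a. holds_at M a \<phi>})"

definition models_of :: "('f, 'r, 'a) fm set \<Rightarrow> ('f, 'r, 'a) struct set" where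
  "models_of T = {N. \<forall>\<phi>\<in>T. holds N \<phi>}"

text \<open>
  Models of a theory range over the structures with universe \<open>'a\<close>. When \<open>'a\<close> carries a monster
  model its cardinality exceeds that of the language, so by Loewenheim--Skolem every infinite
  model of the theory is elementarily equivalent to one of these.
\<close>

definition complete_theory :: "('f, 'r) lang \<Rightarrow> ('f, 'r, 'a) fm set \<Rightarrow> bool" where
  "complete_theory L T \<longleftrightarrow>
     T \<subseteq> sentences_over L {} \<and> models_of T \<noteq> {} \<and>
     (\<forall>\<phi> \<in> sentences_over L {}.
        (\<forall>N \<in> models_of T. holds N \<phi>) \<or> (\<forall>N \<in> models_of T. holds N (Neg \<phi>)))"


section \<open>Monster models\<close>

definition saturated :: "'k rel \<Rightarrow> ('f, 'r) lang \<Rightarrow> ('f, 'r, 'a) struct \<Rightarrow> bool" where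
  "saturated \<kappa> L M \<longleftrightarrow>
     (\<forall>A p. (card_of A, \<kappa>) \<in> ordLess \<and> p \<subseteq> formulas1_over L A \<and>
        (\<forall>q. q \<subseteq> p \<and> finite q \<longrightarrow> (\<exists>a. \<forall>\<phi>\<in>q. holds_at M a \<phi>)) \<longrightarrow>
        (\<exists>a. \<forall>\<phi>\<in>p. holds_at M a \<phi>))"

definition automorphism ::
    "('f, 'r) lang \<Rightarrow> ('f, 'r, 'a) struct \<Rightarrow> ('a \<Rightarrow> 'a) \<Rightarrow> bool" where
  "automorphism L M \<sigma> \<longleftrightarrow> bij \<sigma> \<and>
     (\<forall>f\<in>fun_syms L. \<forall>as. length as = fun_arity L f \<longrightarrow>
        \<sigma> (fun_int M f as) = fun_int M f (map \<sigma> as)) \<and>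
     (\<forall>R\<in>rel_syms L. \<forall>as. length as = rel_arity L R \<longrightarrow>
        rel_int M R (map \<sigma> as) = rel_int M R as)"

text \<open>Replacing each parameter \<open>a\<close> by \<open>g a\<close> expresses that \<open>g\<close> is elementary on \<open>A\<close>.\<close>

definition elementary_on ::
    "('f, 'r) lang \<Rightarrow> ('f, 'r, 'a) struct \<Rightarrow> 'a set \<Rightarrow> ('a \<Rightarrow> 'a) \<Rightarrow> bool" where
  "elementary_on L M A g \<longleftrightarrow>
     (\<forall>\<phi> \<in> sentences_over L A. holds M \<phi> \<longleftrightarrow> holds M (map_pars g \<phi>))"

definition strongly_homogeneous :: "'k rel \<Rightarrow> ('f, 'r) lang \<Rightarrow> ('f, 'r, 'a) struct \<Rightarrow> bool" where
  "strongly_homogeneous \<kappa> L M \<longleftrightarrow>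
     (\<forall>A g. (card_of A, \<kappa>) \<in> ordLess \<and> elementary_on L M A g \<longrightarrow>
        (\<exists>\<sigma>. automorphism L M \<sigma> \<and> (\<forall>a\<in>A. \<sigma> a = g a)))"

text \<open>
  A \<open>\<kappa>\<close>-monster model: \<open>\<kappa>\<close> is a cardinal larger than the number of parameter-free formulas
  (hence uncountable), and the model is \<open>\<kappa>\<close>-saturated and strongly \<open>\<kappa>\<close>-homogeneous.
\<close>

definition monster_model ::
    "'k rel \<Rightarrow> ('f, 'r) lang \<Rightarrow> ('f, 'r, 'a) fm set \<Rightarrow> ('f, 'r, 'a) struct \<Rightarrow> bool" where
  "monster_model \<kappa> L T M \<longleftrightarrow> M \<in> models_of T \<and> Card_order \<kappa> \<and>
     (card_of (formulas_over L {} :: ('f, 'r, 'a) fm set), \<kappa>) \<in> ordLess \<and>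
     saturated \<kappa> L M \<and> strongly_homogeneous \<kappa> L M"


section \<open>Expansions of the language of valued fields\<close>

text \<open>
  The one-sorted language of valued fields has the ring operations and the divisibility relation
  \<open>x | y \<longleftrightarrow> v x \<le> v y\<close>. It is expanded by the constant symbol \<open>t\<close> and by an arbitrary language \<open>L\<close>.
  The sets of symbols of \<open>L\<close> may be empty.
\<close>

datatype 'f vf_fun = Zero | One | Plus | Uminus | Times | Tconst | ExtraF 'f

datatype 'r vf_rel = Div | ExtraR 'r

fun vf_fun_arity :: "('f \<Rightarrow> nat) \<Rightarrow> 'f vf_fun \<Rightarrow> nat" where
  "vf_fun_arity ar Zero = 0"
| "vf_fun_arity ar One = 0"
| "vf_fun_arity ar Plus = 2"
| "vf_fun_arity ar Uminus = 1"
| "vf_fun_arity ar Times = 2"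
| "vf_fun_arity ar Tconst = 0"
| "vf_fun_arity ar (ExtraF f) = ar f"

fun vf_rel_arity :: "('r \<Rightarrow> nat) \<Rightarrow> 'r vf_rel \<Rightarrow> nat" where
  "vf_rel_arity ar Div = 2"
| "vf_rel_arity ar (ExtraR R) = ar R"

definition vf_expansion :: "('f, 'r) lang \<Rightarrow> ('f vf_fun, 'r vf_rel) lang" where
  "vf_expansion L =
     \<lparr>fun_syms = {Zero, One, Plus, Uminus, Times, Tconst} \<union> ExtraF ` fun_syms L,
      fun_arity = vf_fun_arity (fun_arity L),
      rel_syms = {Div} \<union> ExtraR ` rel_syms L,
      rel_arity = vf_rel_arity (rel_arity L)\<rparr>"


section \<open>Valued fields\<close>

text \<open>A valuation with value group \<open>'g\<close>, written additively; \<open>\<infinity>\<close> is attained exactly at \<open>0\<close>.\<close>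

definition valuation :: "('a::field \<Rightarrow> 'g::linordered_ab_group_add extended) \<Rightarrow> bool" where
  "valuation v \<longleftrightarrow>
     (\<forall>x. v x = \<infinity> \<longleftrightarrow> x = 0) \<and> range v = insert \<infinity> (range Fin) \<and>
     (\<forall>x y. v (x * y) = v x + v y) \<and> (\<forall>x y. min (v x) (v y) \<le> v (x + y))"

definition nontrivial :: "('a::field \<Rightarrow> 'g::linordered_ab_group_add extended) \<Rightarrow> bool" where
  "nontrivial v \<longleftrightarrow> (\<exists>x. x \<noteq> 0 \<and> v x \<noteq> 0)"

text \<open>
  Algebraic closedness of the field is provided by the type class. Being a model of ACVF is
  elementary, so if the theory of \<open>M\<close> is complete then it contains ACVF.
\<close>

definition expands_ACVF ::
    "('f vf_fun, 'r vf_rel, 'a::alg_closed_field) struct \<Rightarrow>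
      ('a \<Rightarrow> 'g::linordered_ab_group_add extended) \<Rightarrow> bool" where
  "expands_ACVF M v \<longleftrightarrow> valuation v \<and> nontrivial v \<and>
     fun_int M Zero [] = 0 \<and> fun_int M One [] = 1 \<and>
     (\<forall>x y. fun_int M Plus [x, y] = x + y) \<and>
     (\<forall>x. fun_int M Uminus [x] = - x) \<and>
     (\<forall>x y. fun_int M Times [x, y] = x * y) \<and>
     (\<forall>x y. rel_int M Div [x, y] \<longleftrightarrow> v x \<le> v y)"


section \<open>C-minimality\<close>

inductive_set bool_combs :: "'a set set \<Rightarrow> 'a set set" for \<B> where
  base: "X \<in> \<B> \<Longrightarrow> X \<in> bool_combs \<B>"
| compl: "X \<in> bool_combs \<B> \<Longrightarrow> - X \<in> bool_combs \<B>"
| union: "X \<in> bool_combs \<B> \<Longrightarrow> Y \<in> bool_combs \<B> \<Longrightarrow> X \<union> Y \<in> bool_combs \<B>"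

text \<open>
  Balls are expressed in the language, as C-minimality is a property of a theory and has to make
  sense in all its models: \<open>c \<noteq> 0\<close> represents the radius \<open>v c\<close>, so these are the closed balls
  \<open>v (x - a) \<ge> v c\<close> and the open balls \<open>v (x - a) > v c\<close>.
\<close>

definition minus_in ::
    "('f vf_fun, 'r vf_rel, 'a) struct \<Rightarrow> 'a \<Rightarrow> 'a \<Rightarrow> 'a" where
  "minus_in N x a = fun_int N Plus [x, fun_int N Uminus [a]]"

definition closed_balls :: "('f vf_fun, 'r vf_rel, 'a) struct \<Rightarrow> 'a set set" where
  "closed_balls N =
     {{x. rel_int N Div [c, minus_in N x a]} | a c. c \<noteq> fun_int N Zero []}"

definition open_balls :: "('f vf_fun, 'r vf_rel, 'a) struct \<Rightarrow> 'a set set" where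
  "open_balls N =
     {{x. \<not> rel_int N Div [minus_in N x a, c]} | a c. c \<noteq> fun_int N Zero []}"

definition C_minimal ::
    "('f vf_fun, 'r vf_rel) lang \<Rightarrow> ('f vf_fun, 'r vf_rel, 'a) fm set \<Rightarrow> bool" where
  "C_minimal L T \<longleftrightarrow>
     (\<forall>N \<in> models_of T. \<forall>X. definable L N X \<longrightarrow>
        X \<in> bool_combs (closed_balls N \<union> open_balls N \<union> range (\<lambda>a. {a})))"


section \<open>RV and the value group\<close>

definition max_ideal :: "('a::field \<Rightarrow> 'g::linordered_ab_group_add extended) \<Rightarrow> 'a set" where
  "max_ideal v = {x. v x > 0}"

text \<open>The class of \<open>x\<close> modulo \<open>1 + m\<close>, as a coset.\<close>

definition rv ::
    "('a::field \<Rightarrow> 'g::linordered_ab_group_add extended) \<Rightarrow> 'a \<Rightarrow> 'a set" where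
  "rv v x = {x * (1 + y) | y. y \<in> max_ideal v}"

definition RV :: "('a::field \<Rightarrow> 'g::linordered_ab_group_add extended) \<Rightarrow> 'a set set" where
  "RV v = rv v ` (UNIV - {0})"

definition val_RV ::
    "('a::field \<Rightarrow> 'g::linordered_ab_group_add extended) \<Rightarrow> 'a set \<Rightarrow> 'g" where
  "val_RV v c = (THE \<gamma>. \<forall>x\<in>c. v x = Fin \<gamma>)"

definition RV_over ::
    "('a::field \<Rightarrow> 'g::linordered_ab_group_add extended) \<Rightarrow> 'g set \<Rightarrow> 'a set set" where
  "RV_over v S = {c \<in> RV v. val_RV v c \<in> S}"

text \<open>
  RV and the value group are imaginary sorts, quotients of the nonzero elements of the field. A
  subset of such a sort is definable iff its preimage in the field is.
\<close>

definition definable_RV ::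
    "('f vf_fun, 'r vf_rel) lang \<Rightarrow> ('f vf_fun, 'r vf_rel, 'a::field) struct \<Rightarrow>
      ('a \<Rightarrow> 'g::linordered_ab_group_add extended) \<Rightarrow> 'a set set \<Rightarrow> bool" where
  "definable_RV L M v D \<longleftrightarrow> D \<subseteq> RV v \<and> definable L M {x. x \<noteq> 0 \<and> rv v x \<in> D}"

definition definable_VG ::
    "('f vf_fun, 'r vf_rel) lang \<Rightarrow> ('f vf_fun, 'r vf_rel, 'a::field) struct \<Rightarrow>
      ('a \<Rightarrow> 'g::linordered_ab_group_add extended) \<Rightarrow> 'g set \<Rightarrow> bool" where
  "definable_VG L M v S \<longleftrightarrow> definable L M {x. v x \<in> Fin ` S}"

end

theory Submission
  imports Defs
begin

text \<open>
  The preimage of \<open>D\<close> in the field is a finite boolean combination of balls and points. A ball (or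
  point) that avoids \<open>0\<close> lies in a single class of RV, and a ball around \<open>0\<close> is, away from \<open>0\<close>, the
  preimage of an upper set of the value group. So off finitely many classes of RV, membership in \<open>D\<close>
  depends only on the value.
\<close>

section \<open>Ultrametric inequalities and the classes of RV\<close>

lemma extended_add_strict_left_mono:
  fixes a :: "'g::linordered_ab_group_add"
  assumes "y < z"
  shows "Fin a + y < Fin a + z"
  using assms by (cases y; cases z) auto

context
  fixes v :: "'a::field \<Rightarrow> 'g::linordered_ab_group_add extended"
  assumes val: "valuation v"
begin

lemma valuation_zero [simp]: "v 0 = \<infinity>"
  using val by (simp add: valuation_def)

lemma valuation_mult: "v (x * y) = v x + v y"
  using val by (simp add: valuation_def)

lemma valuation_add: "min (v x) (v y) \<le> v (x + y)"
  using val by (simp add: valuation_def)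

lemma valuation_cases:
  obtains "x = 0" "v x = \<infinity>" | \<gamma> where "x \<noteq> 0" "v x = Fin \<gamma>"
proof -
  have "v x \<in> insert \<infinity> (range Fin)" and "v x = \<infinity> \<longleftrightarrow> x = 0"
    using val unfolding valuation_def by auto
  then show thesis
    using that by auto
qed

lemma valuation_one [simp]: "v 1 = 0"
proof (cases "1 :: 'a" rule: valuation_cases)
  case (2 \<gamma>)
  then show ?thesis
    using valuation_mult[of 1 1] by (simp add: zero_extended_def)
qed simp

lemma valuation_uminus [simp]: "v (- x) = v x"
proof -
  have "v (- 1) = 0"
  proof (cases "- 1 :: 'a" rule: valuation_cases)
    case (2 \<gamma>)
    \<comment> \<open>The square of -1 is 1, which has value 0; a linearly ordered group has no
      torsion, so \<gamma> itself vanishes.\<close>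
    then have "\<gamma> + \<gamma> = 0"
      using valuation_mult[of "- 1" "- 1"] by (simp add: zero_extended_def)
    then show ?thesis
      using 2 by (simp add: zero_extended_def)
  qed simp
  then show ?thesis
    using valuation_mult[of "- 1" x] by (cases "v x") (simp_all add: zero_extended_def)
qed

lemma valuation_minus_commute: "v (x - y) = v (y - x)"
  using valuation_uminus[of "x - y"] by simp

lemma valuation_add_gt: "c < v x \<Longrightarrow> c < v y \<Longrightarrow> c < v (x + y)"
  using valuation_add[of x y] by (auto simp: min_def split: if_splits)

lemma valuation_add_ge: "c \<le> v x \<Longrightarrow> c \<le> v y \<Longrightarrow> c \<le> v (x + y)"
  using valuation_add[of x y] by (auto simp: min_def split: if_splits)

lemma valuation_eq_of_close:
  assumes "v a < v (x - a)"
  shows "v x = v a"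
proof (rule antisym)
  show "v a \<le> v x"
    using valuation_add_ge[of "v a" "x - a" a] assms by simp
  show "v x \<le> v a"
  proof (rule ccontr)
    assume "\<not> v x \<le> v a"
    \<comment> \<open>Both summands of a = x + (a - x) would have value above \<open>v a\<close>,
      and so would \<open>a\<close>.\<close>
    then have "v a < v (x + (a - x))"
      using assms by (intro valuation_add_gt) (auto simp: valuation_minus_commute[of a x])
    then show False
      by simp
  qed
qed

text \<open>Multiplication by x carries 1 + m onto x + x m, and x m consists of the elements of
  value above \<open>v x\<close>. In this form classes can be compared with balls by ultrametric
  arguments.\<close>

lemma rv_eq_open_ball:
  assumes "x \<noteq> 0"
  shows "rv v x = {y. v x < v (y - x)}"
proof (intro set_eqI iffI)
  obtain \<gamma> where \<gamma>: "v x = Fin \<gamma>"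
    using assms by (cases x rule: valuation_cases) auto
  fix y
  {
    assume "y \<in> rv v x"
    then obtain z where z: "y = x * (1 + z)" "0 < v z"
      by (auto simp: rv_def max_ideal_def)
    have "v (y - x) = v x + v z"
      using z by (simp add: algebra_simps valuation_mult)
    then show "y \<in> {y. v x < v (y - x)}"
      using extended_add_strict_left_mono[OF z(2), of \<gamma>] \<gamma> by (simp add: zero_extended_def)
  next
    assume "y \<in> {y. v x < v (y - x)}"
    define z where "z = (y - x) / x"
    have y: "y = x * (1 + z)" "y - x = x * z"
      using assms by (auto simp: z_def field_simps)
    \<comment> \<open>Since x is nonzero its value \<gamma> is finite and can be cancelled.\<close>
    have "Fin \<gamma> < Fin \<gamma> + v z"
      using \<open>y \<in> _\<close> by (simp add: y(2) valuation_mult \<gamma>)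
    then have "0 < v z"
      by (cases "v z") (auto simp: zero_extended_def)
    then show "y \<in> rv v x"
      using y(1) by (auto simp: rv_def max_ideal_def)
  }
qed

text \<open>Both classes are open balls of radius \<open>v a\<close>, and every point of an
  ultrametric ball is a centre of it. This is what confines a ball avoiding 0 to one class.\<close>

lemma rv_eqI:
  assumes "a \<noteq> 0" and "v a < v (x - a)"
  shows "rv v x = rv v a"
proof -
  have vx: "v x = v a"
    using assms(2) by (rule valuation_eq_of_close)
  then have "x \<noteq> 0"
    using assms(1) by (metis valuation_cases extended.distinct(1) valuation_zero)
  have "v a < v (y - x) \<longleftrightarrow> v a < v (y - a)" for y
    using valuation_add_gt[of "v a" "y - x" "x - a"] valuation_add_gt[of "v a" "y - a" "a - x"]
      assms(2) by (auto simp: valuation_minus_commute[of a x])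
  then show ?thesis
    using assms(1) \<open>x \<noteq> 0\<close> by (simp add: rv_eq_open_ball vx)
qed

lemma val_RV_rv:
  assumes "v x = Fin \<gamma>"
  shows "val_RV v (rv v x) = \<gamma>"
  unfolding val_RV_def
proof (rule the_equality)
  have x: "x \<noteq> 0"
    using assms by auto
  have "v y = v x" if "y \<in> rv v x" for y
    using that by (intro valuation_eq_of_close) (simp add: rv_eq_open_ball[OF x])
  then show "\<forall>y\<in>rv v x. v y = Fin \<gamma>"
    using assms by simp
  \<comment> \<open>The class is nonempty: it contains x, because v (x - x) = \<infinity> exceeds
    the finite \<open>v x\<close>.\<close>
  show "\<delta> = \<gamma>" if "\<forall>y\<in>rv v x. v y = Fin \<delta>" for \<delta>
    using that[rule_format, of x] assms by (simp add: rv_eq_open_ball[OF x])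
qed

end

section \<open>Closure properties of definable subsets of the field\<close>

lemma definable_Compl:
  assumes "definable L M X"
  shows "definable L M (- X)"
proof -
  obtain \<phi> where "\<phi> \<in> formulas1_over L UNIV" "X = {a. holds_at M a \<phi>}"
    using assms by (auto simp: definable_def)
  then show ?thesis
    unfolding definable_def
    by (intro bexI[of _ "Neg \<phi>"]) (auto simp: formulas1_over_def formulas_over_def holds_at_def)
qed

lemma definable_Int:
  assumes "definable L M X" and "definable L M Y"
  shows "definable L M (X \<inter> Y)"
proof -
  obtain \<phi> \<psi> where "\<phi> \<in> formulas1_over L UNIV" "X = {a. holds_at M a \<phi>}"
    "\<psi> \<in> formulas1_over L UNIV" "Y = {a. holds_at M a \<psi>}"
    using assms by (auto simp: definable_def)
  then show ?thesis
    unfolding definable_def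
    by (intro bexI[of _ "Conj \<phi> \<psi>"]) (auto simp: formulas1_over_def formulas_over_def holds_at_def)
qed

lemma definable_Un:
  assumes "definable L M X" and "definable L M Y"
  shows "definable L M (X \<union> Y)"
  using definable_Compl[OF definable_Int[OF assms[THEN definable_Compl]]]
  by simp

lemma definable_singleton: "definable L M {a}"
  unfolding definable_def
  by (intro bexI[of _ "Eq (Var 0) (Par a)"])
    (auto simp: formulas1_over_def formulas_over_def holds_at_def)

lemma definable_Div_left: "definable (vf_expansion L\<^sub>0) M {x. rel_int M Div [c, x]}"
  unfolding definable_def
  by (intro bexI[of _ "Rel Div [Par c, Var 0]"])
    (auto simp: formulas1_over_def formulas_over_def holds_at_def vf_expansion_def)

lemma definable_Div_right: "definable (vf_expansion L\<^sub>0) M {x. rel_int M Div [x, c]}"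
  unfolding definable_def
  by (intro bexI[of _ "Rel Div [Var 0, Par c]"])
    (auto simp: formulas1_over_def formulas_over_def holds_at_def vf_expansion_def)

section \<open>Definable sets of values, and boolean combinations of balls\<close>

context
  fixes L\<^sub>0 :: "('f, 'r) lang"
    and M :: "('f vf_fun, 'r vf_rel, 'a::alg_closed_field) struct"
    and v :: "'a \<Rightarrow> 'g::linordered_ab_group_add extended"
  assumes expands: "expands_ACVF M v"
begin

lemma expands_ACVF_valuation: "valuation v"
  using expands by (simp add: expands_ACVF_def)

lemma Div_iff: "rel_int M Div [x, y] \<longleftrightarrow> v x \<le> v y"
  using expands by (simp add: expands_ACVF_def)

lemma minus_in_eq: "minus_in M x a = x - a"
  using expands by (simp add: expands_ACVF_def minus_in_def)

text \<open>The point 0 has value \<infinity>, which is not of the form \<open>Fin \<gamma>\<close>,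
  so it has to be removed even when P holds at \<infinity>. Each definability proof for a set of
  values therefore cuts with \<open>- {0}\<close>.\<close>

lemma vimage_value_set: "{x. v x \<in> Fin ` {\<gamma>. P (Fin \<gamma>)}} = {x. P (v x)} \<inter> - {0}"
proof -
  have "v x \<in> Fin ` {\<gamma>. P (Fin \<gamma>)} \<longleftrightarrow> P (v x) \<and> x \<noteq> 0" for x
    by (cases x rule: valuation_cases[OF expands_ACVF_valuation]) auto
  then show ?thesis
    by auto
qed

lemma definable_VG_Compl:
  assumes "definable_VG (vf_expansion L\<^sub>0) M v S"
  shows "definable_VG (vf_expansion L\<^sub>0) M v (- S)"
proof -
  have "{x. v x \<in> Fin ` (- S)} = - {x. v x \<in> Fin ` S} \<inter> - {0}"
    using vimage_value_set[of "\<lambda>\<gamma>. \<gamma> \<notin> Fin ` S"] by (auto simp: Compl_eq image_iff)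
  then show ?thesis
    using assms unfolding definable_VG_def
    by (simp add: definable_Int definable_Compl definable_singleton)
qed

lemma definable_VG_Un:
  assumes "definable_VG (vf_expansion L\<^sub>0) M v S" and "definable_VG (vf_expansion L\<^sub>0) M v S'"
  shows "definable_VG (vf_expansion L\<^sub>0) M v (S \<union> S')"
proof -
  have "{x. v x \<in> Fin ` (S \<union> S')} = {x. v x \<in> Fin ` S} \<union> {x. v x \<in> Fin ` S'}"
    by auto
  then show ?thesis
    using assms unfolding definable_VG_def by (simp add: definable_Un)
qed

lemma definable_VG_empty: "definable_VG (vf_expansion L\<^sub>0) M v {}"
  using definable_Int[OF definable_singleton definable_Compl[OF definable_singleton], of _ M 0 0]
  by (simp add: definable_VG_def)

lemma definable_VG_atLeast: "definable_VG (vf_expansion L\<^sub>0) M v {\<gamma>. v c \<le> Fin \<gamma>}"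
proof -
  have "{x. v x \<in> Fin ` {\<gamma>. v c \<le> Fin \<gamma>}} = {x. rel_int M Div [c, x]} \<inter> - {0}"
    by (auto simp: Div_iff vimage_value_set)
  then show ?thesis
    unfolding definable_VG_def
    by (simp add: definable_Int definable_Compl definable_singleton definable_Div_left)
qed

lemma definable_VG_greaterThan: "definable_VG (vf_expansion L\<^sub>0) M v {\<gamma>. v c < Fin \<gamma>}"
proof -
  have "{x. v x \<in> Fin ` {\<gamma>. v c < Fin \<gamma>}} = - {x. rel_int M Div [x, c]} \<inter> - {0}"
    by (auto simp: Div_iff vimage_value_set)
  then show ?thesis
    unfolding definable_VG_def
    by (simp add: definable_Int definable_Compl definable_singleton definable_Div_right)
qed

text \<open>A ball need not be a union of classes, so the induction runs over arbitrary subsets of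
  the field, and F collects the classes that may be split or exceptional. A complement keeps F; a
  union joins the two exceptional sets.\<close>

lemma bool_comb_determined_by_value:
  assumes "X \<in> bool_combs (closed_balls M \<union> open_balls M \<union> range (\<lambda>a. {a}))"
  shows "\<exists>S F. definable_VG (vf_expansion L\<^sub>0) M v S \<and> finite F \<and>
    (\<forall>x. x \<noteq> 0 \<and> rv v x \<notin> F \<longrightarrow> (x \<in> X \<longleftrightarrow> v x \<in> Fin ` S))"
  using assms
proof (induction rule: bool_combs.induct)
  case (base X)
  \<comment> \<open>If the nonzero part of X lies in one class, that class is the only exception and
    no values are needed. For X = {0} the assumption is vacuous.\<close>
  have avoiding_zero: ?case if "\<forall>x\<in>X. x \<noteq> 0 \<longrightarrow> rv v x = rv v a" for a
  proof (intro exI conjI)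
    show "definable_VG (vf_expansion L\<^sub>0) M v {}"
      by (rule definable_VG_empty)
    show "finite {rv v a}"
      by simp
    show "\<forall>x. x \<noteq> 0 \<and> rv v x \<notin> {rv v a} \<longrightarrow> (x \<in> X \<longleftrightarrow> v x \<in> Fin ` {})"
      using that by auto
  qed
  from base consider (closed) a c where "X = {x. v c \<le> v (x - a)}"
    | (opened) a c where "X = {x. v c < v (x - a)}" | (point) a where "X = {a}"
    by (auto simp: closed_balls_def open_balls_def Div_iff minus_in_eq not_le)
  then show ?case
  proof cases
    case closed
    show ?thesis
    proof (cases "v c \<le> v a")
      case True
      \<comment> \<open>Here 0 lies in the ball and may serve as its centre: x = (x - a) + a and x -
        a = x + (- a) give the two directions.\<close>
      have "x \<in> X \<longleftrightarrow> v x \<in> Fin ` {\<gamma>. v c \<le> Fin \<gamma>}" if "x \<noteq> 0" for x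
        using that True valuation_add_ge[OF expands_ACVF_valuation, of "v c" "x - a" a]
          valuation_add_ge[OF expands_ACVF_valuation, of "v c" x "- a"]
        by (cases x rule: valuation_cases[OF expands_ACVF_valuation])
          (auto simp: closed valuation_uminus[OF expands_ACVF_valuation])
      then show ?thesis
        using definable_VG_atLeast by (intro exI[of _ "{\<gamma>. v c \<le> Fin \<gamma>}"] exI[of _ "{}"]) auto
    next
      case False
      then have "a \<noteq> 0"
        using valuation_zero[OF expands_ACVF_valuation] by auto
      \<comment> \<open>Now 0 is outside the ball, and v a < v c \<le> v (x - a) puts x into the
        class of \<open>a\<close>.\<close>
      have "rv v x = rv v a" if "x \<in> X" for x
        using that False \<open>a \<noteq> 0\<close> by (intro rv_eqI[OF expands_ACVF_valuation]) (auto simp: closed)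
      then show ?thesis
        by (intro avoiding_zero[of a] ballI impI)
    qed
  next
    case opened
    show ?thesis
    proof (cases "v c < v a")
      case True
      have "x \<in> X \<longleftrightarrow> v x \<in> Fin ` {\<gamma>. v c < Fin \<gamma>}" if "x \<noteq> 0" for x
        using that True valuation_add_gt[OF expands_ACVF_valuation, of "v c" "x - a" a]
          valuation_add_gt[OF expands_ACVF_valuation, of "v c" x "- a"]
        by (cases x rule: valuation_cases[OF expands_ACVF_valuation])
          (auto simp: opened valuation_uminus[OF expands_ACVF_valuation])
      then show ?thesis
        using definable_VG_greaterThan
        by (intro exI[of _ "{\<gamma>. v c < Fin \<gamma>}"] exI[of _ "{}"]) auto
    next
      case False
      have "rv v x = rv v a" if "x \<in> X" for x
      proof -
        \<comment> \<open>The case only gives the weak \<open>v a \<le> v c\<close>; strictness, and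
          with it a \<noteq> 0, comes from the point x of the open ball.\<close>
        have "v a < v (x - a)"
          using that False by (auto simp: opened)
        moreover from this have "a \<noteq> 0"
          using valuation_zero[OF expands_ACVF_valuation] by auto
        ultimately show ?thesis
          by (intro rv_eqI[OF expands_ACVF_valuation])
      qed
      then show ?thesis
        by (intro avoiding_zero[of a] ballI impI)
    qed
  next
    case point
    then show ?thesis
      by (intro avoiding_zero[of a]) auto
  qed
next
  case (compl X)
  then obtain S F where "definable_VG (vf_expansion L\<^sub>0) M v S" "finite F"
    and *: "\<forall>x. x \<noteq> 0 \<and> rv v x \<notin> F \<longrightarrow> (x \<in> X \<longleftrightarrow> v x \<in> Fin ` S)"
    by (elim exE conjE)
  \<comment> \<open>A nonzero x has a finite value, and \<open>Fin\<close> is injective, so that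
    value misses the image of S exactly when it is in the image of \<open>- S\<close>.\<close>
  moreover have "x \<in> - X \<longleftrightarrow> v x \<in> Fin ` (- S)" if "x \<noteq> 0" "rv v x \<notin> F" for x
    using that *[rule_format, of x]
    by (cases x rule: valuation_cases[OF expands_ACVF_valuation]) auto
  ultimately show ?case
    by (intro exI[of _ "- S"] exI[of _ F]) (auto simp: definable_VG_Compl)
next
  case (union X Y)
  from union.IH(1) obtain S F where S: "definable_VG (vf_expansion L\<^sub>0) M v S" "finite F"
    and X: "\<forall>x. x \<noteq> 0 \<and> rv v x \<notin> F \<longrightarrow> (x \<in> X \<longleftrightarrow> v x \<in> Fin ` S)"
    by (elim exE conjE)
  from union.IH(2) obtain S' F' where S': "definable_VG (vf_expansion L\<^sub>0) M v S'" "finite F'"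
    and Y: "\<forall>x. x \<noteq> 0 \<and> rv v x \<notin> F' \<longrightarrow> (x \<in> Y \<longleftrightarrow> v x \<in> Fin ` S')"
    by (elim exE conjE)
  show ?case
  proof (intro exI conjI allI impI)
    show "definable_VG (vf_expansion L\<^sub>0) M v (S \<union> S')"
      using S(1) S'(1) by (rule definable_VG_Un)
    show "finite (F \<union> F')"
      using S(2) S'(2) by simp
    show "x \<in> X \<union> Y \<longleftrightarrow> v x \<in> Fin ` (S \<union> S')" if "x \<noteq> 0 \<and> rv v x \<notin> F \<union> F'" for x
      using that X[rule_format, of x] Y[rule_format, of x] by (simp add: image_Un)
  qed
qed

end

section \<open>From the field back to RV\<close>

theorem theorem2p16:
  fixes L\<^sub>0 :: "('f, 'r) lang"
    and L :: "('f vf_fun, 'r vf_rel) lang"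
    and T :: "('f vf_fun, 'r vf_rel, 'a::alg_closed_field) fm set"
    and M :: "('f vf_fun, 'r vf_rel, 'a) struct"
    and v :: "'a \<Rightarrow> 'g::linordered_ab_group_add extended"
    and \<kappa> :: "'k rel"
    and D :: "'a set set"
  defines "L \<equiv> vf_expansion L\<^sub>0"
  assumes "complete_theory L T"
    and "C_minimal L T"
    and "monster_model \<kappa> L T M"
    and "expands_ACVF M v"
    and "v (fun_int M Tconst []) > 0"
    and "definable_RV L M v D"
  shows "\<exists>D' :: 'g set. definable_VG L M v D' \<and> finite (sym_diff D (RV_over v D'))"
proof -
  let ?X = "{x. x \<noteq> 0 \<and> rv v x \<in> D}"
  have D: "D \<subseteq> RV v" and "definable L M ?X"
    using assms(7) by (auto simp: definable_RV_def)
  \<comment> \<open>C-minimality is assumed of all models of T, and a monster model is one of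
    them.\<close>
  then have "?X \<in> bool_combs (closed_balls M \<union> open_balls M \<union> range (\<lambda>a. {a}))"
    using assms(3,4) by (auto simp: C_minimal_def monster_model_def)
  from bool_comb_determined_by_value[OF assms(5) this, of L\<^sub>0]
  obtain S F where S: "definable_VG L M v S" "finite F"
    and *: "\<And>x. x \<noteq> 0 \<Longrightarrow> rv v x \<notin> F \<Longrightarrow> rv v x \<in> D \<longleftrightarrow> v x \<in> Fin ` S"
    unfolding L_def by auto
  have val: "valuation v"
    using assms(5) by (rule expands_ACVF_valuation)
  \<comment> \<open>For a class outside F, membership in D and membership in
    \<open>RV_over v S\<close> both amount to the value of a representative lying in S.\<close>
  have "sym_diff D (RV_over v S) \<subseteq> F"
  proof
    fix r
    assume r: "r \<in> sym_diff D (RV_over v S)"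
    then have "r \<in> RV v"
      using D by (auto simp: RV_over_def)
    then obtain x where x: "x \<noteq> 0" "r = rv v x"
      by (auto simp: RV_def)
    obtain \<gamma> where \<gamma>: "v x = Fin \<gamma>"
      using x(1) by (cases x rule: valuation_cases[OF val]) auto
    have "r \<in> RV_over v S \<longleftrightarrow> v x \<in> Fin ` S"
      using \<open>r \<in> RV v\<close> val_RV_rv[OF val \<gamma>] \<gamma> x(2) by (auto simp: RV_over_def)
    then show "r \<in> F"
      using r *[OF x(1)] x(2) by auto
  qed
  then show ?thesis
    using S finite_subset by blast
qed

end
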